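(* Let $\mathcal{C}\subset\mathbb{R}^n$ be $\alpha$-prox-regular for some $\alpha>0$, let $x\in\mathcal{C}+\frac{1}{2\alpha}\operatorname{int}\mathbb{B}$ and $v\in\mathbb{R}^n$, and suppose that the directional derivative $DP_{\mathcal{C}}(x;v)$ exists. Then $DP_{\mathcal{C}}(x;v)\in T_{P_{\mathcal{C}}(x)}\mathcal{C}$.
   Context: $\mathbb{R}^n$ carries the usual inner product and 2-norm; $\operatorname{int}\mathbb{B}$ is the open unit ball. $P_{\mathcal{C}}(x)$ is the set of points of $\mathcal{C}$ at minimal Euclidean distance from $x$. $T_x\mathcal{C}$ is the (Bouligand) tangent cone of $\mathcal{C}$ at $x\in\mathcal{C}$. $\mathcal{C}$ is Clarke regular if it is closed and $x\mapsto T_x\mathcal{C}$ is inner semicontinuous; then $N_x\mathcal{C}$ denotes the normal cone, i.e., the polar cone of $T_x\mathcal{C}$. Given $\alpha>0$, a Clarke regular set $\mathcal{C}$ is $\alpha$-prox-regular if for every $x\in\mathcal{C}$ and every $\eta\in N_x\mathcal{C}$ one has $\langle\eta,y-x\rangle\le\alpha\|\eta\|\|y-x\|^2$ for all $y\in\mathcal{C}$. It is known that then $P_{\mathcal{C}}$ is single-valued on the open set $\mathcal{C}+\frac{1}{2\alpha}\operatorname{int}\mathbb{B}$. The directional derivative is $DP_{\mathcal{C}}(x;v):=\lim_{h\to0^+}\frac{P_{\mathcal{C}}(x+hv)-P_{\mathcal{C}}(x)}{h}$. *)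

theory Defs
  imports "HOL-Analysis.Analysis"
begin

definition proj_set :: "'a::metric_space set \<Rightarrow> 'a \<Rightarrow> 'a set" where
  "proj_set C x = {y \<in> C. \<forall>z\<in>C. dist x y \<le> dist x z}"

(* Unspecified at points where the set of nearest points is not a singleton. *)
definition proj :: "'a::metric_space set \<Rightarrow> 'a \<Rightarrow> 'a" where
  "proj C x = the_elem (proj_set C x)"

(* Bouligand tangent cone at x; only meaningful for x in C. *)
definition tangent_cone :: "'a::real_normed_vector set \<Rightarrow> 'a \<Rightarrow> 'a set" where
  "tangent_cone C x =
     {v. \<exists>xs :: nat \<Rightarrow> 'a. \<exists>\<delta> :: nat \<Rightarrow> real.
           (\<forall>k. xs k \<in> C) \<and> xs \<longlonglongrightarrow> x \<and>
           (\<forall>k. \<delta> k > 0) \<and> \<delta> \<longlonglongrightarrow> 0 \<and>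
           (\<lambda>k. (xs k - x) /\<^sub>R \<delta> k) \<longlonglongrightarrow> v}"

definition polar_cone :: "'a::real_inner set \<Rightarrow> 'a set" where
  "polar_cone K = {\<eta>. \<forall>v\<in>K. \<eta> \<bullet> v \<le> 0}"

(* Relative to S: only sequences inside S are considered. *)
definition inner_semicontinuous_on ::
    "'a::topological_space set \<Rightarrow> ('a \<Rightarrow> 'b::topological_space set) \<Rightarrow> bool" where
  "inner_semicontinuous_on S F \<longleftrightarrow>
     (\<forall>x\<in>S. \<forall>xs :: nat \<Rightarrow> 'a. (\<forall>k. xs k \<in> S) \<longrightarrow> xs \<longlonglongrightarrow> x \<longrightarrow>
        (\<forall>v\<in>F x. \<exists>vs :: nat \<Rightarrow> 'b. (\<forall>\<^sub>F k in sequentially. vs k \<in> F (xs k)) \<and> vs \<longlonglongrightarrow> v))"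

definition clarke_regular :: "'a::real_normed_vector set \<Rightarrow> bool" where
  "clarke_regular C \<longleftrightarrow> closed C \<and> inner_semicontinuous_on C (tangent_cone C)"

definition normal_cone :: "'a::real_inner set \<Rightarrow> 'a \<Rightarrow> 'a set" where
  "normal_cone C x = polar_cone (tangent_cone C x)"

definition prox_regular :: "real \<Rightarrow> 'a::real_inner set \<Rightarrow> bool" where
  "prox_regular \<alpha> C \<longleftrightarrow> clarke_regular C \<and>
     (\<forall>x\<in>C. \<forall>\<eta>\<in>normal_cone C x. \<forall>y\<in>C. \<eta> \<bullet> (y - x) \<le> \<alpha> * norm \<eta> * (norm (y - x))\<^sup>2)"

definition has_directional_derivative ::
    "('a::real_normed_vector \<Rightarrow> 'b::real_normed_vector) \<Rightarrow> 'b \<Rightarrow> 'a \<Rightarrow> 'a \<Rightarrow> bool" where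
  "has_directional_derivative f d x v \<longleftrightarrow>
     ((\<lambda>h::real. (f (x + h *\<^sub>R v) - f x) /\<^sub>R h) \<longlongrightarrow> d) (at_right 0)"

end

theory Submission
  imports Defs
begin

text \<open>
  If \<open>p\<close> is nearest to \<open>y\<close> in \<open>C\<close>, then \<open>y - p\<close> is normal to \<open>C\<close> at \<open>p\<close>. For a second nearest
  point \<open>q\<close>, equality of the distances gives \<open>2 \<langle>y - p, q - p\<rangle> = \<parallel>q - p\<parallel>\<^sup>2\<close>, which contradicts
  the prox-regularity inequality when \<open>\<parallel>y - p\<parallel> < 1/(2\<alpha>)\<close> unless \<open>p = q\<close>. So the projection is
  single-valued on the tube, and the points \<open>P(x + h v)\<close> for \<open>h = \<epsilon>/(k+1)\<close> lie in \<open>C\<close> and witness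
  that the limit of their difference quotients is tangent at \<open>P(x)\<close>.
\<close>

text \<open>Points of \<open>C\<close> near \<open>p\<close> are no closer to \<open>y\<close> than
  \<open>p\<close>. Expanding the squared distances bounds a term linear in \<open>xs k - p\<close>
  by a quadratic one, which vanishes in the limit after division by
  \<open>\<delta> k\<close>.\<close>

lemma proj_set_normal:
  fixes C :: "'a::real_inner set"
  assumes "p \<in> proj_set C y"
  shows "y - p \<in> normal_cone C p"
  unfolding normal_cone_def polar_cone_def
proof (intro CollectI ballI)
  fix v assume "v \<in> tangent_cone C p"
  then obtain xs \<delta> where xs: "\<And>k. xs k \<in> C" "xs \<longlonglongrightarrow> p"
    and \<delta>: "\<And>k. \<delta> k > (0::real)"
    and lim: "(\<lambda>k. (xs k - p) /\<^sub>R \<delta> k) \<longlonglongrightarrow> v"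
    unfolding tangent_cone_def by blast
  \<comment> \<open>On the right only one factor is divided by \<open>\<delta> k\<close>: that one
    tends to \<open>v\<close>, the other to 0.\<close>
  have le: "2 * ((y - p) \<bullet> ((xs k - p) /\<^sub>R \<delta> k)) \<le> (xs k - p) \<bullet> ((xs k - p) /\<^sub>R \<delta> k)" for k
  proof -
    have "norm (y - p) \<le> norm (y - xs k)"
      using assms xs(1) by (auto simp: proj_set_def dist_norm)
    then have "(y - p) \<bullet> (y - p) \<le> (y - xs k) \<bullet> (y - xs k)"
      by (simp add: norm_le)
    then have "2 * ((y - p) \<bullet> (xs k - p)) \<le> (xs k - p) \<bullet> (xs k - p)"
      by (simp add: inner_diff_left inner_diff_right inner_commute)
    from mult_left_mono[OF this, of "inverse (\<delta> k)"] show ?thesis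
      using \<delta>[of k] by (simp add: mult_ac)
  qed
  have "(\<lambda>k. 2 * ((y - p) \<bullet> ((xs k - p) /\<^sub>R \<delta> k))) \<longlonglongrightarrow> 2 * ((y - p) \<bullet> v)"
    by (intro tendsto_intros lim)
  moreover have "(\<lambda>k. (xs k - p) \<bullet> ((xs k - p) /\<^sub>R \<delta> k)) \<longlonglongrightarrow> (p - p) \<bullet> v"
    by (intro tendsto_intros lim xs)
  ultimately have "2 * ((y - p) \<bullet> v) \<le> (p - p) \<bullet> v"
    using le by (blast intro: LIMSEQ_le)
  then show "(y - p) \<bullet> v \<le> 0" by simp
qed

lemma prox_regular_proj_set_unique:
  fixes C :: "'a::real_inner set"
  assumes "prox_regular \<alpha> C" and p: "p \<in> proj_set C y" and q: "q \<in> proj_set C y"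
    and near: "2 * \<alpha> * dist y p < 1"
  shows "q = p"
proof (rule ccontr)
  assume "q \<noteq> p"
  have "p \<in> C" "q \<in> C" and "dist y p = dist y q"
    using p q by (auto simp: proj_set_def intro: antisym)
  then have "(y - p) \<bullet> (y - p) = (y - q) \<bullet> (y - q)"
    by (simp add: dist_norm norm_eq)
  then have "(norm (q - p))\<^sup>2 = 2 * ((y - p) \<bullet> (q - p))"
    by (simp add: power2_norm_eq_inner inner_diff_left inner_diff_right inner_commute)
  also have "\<dots> \<le> 2 * \<alpha> * dist y p * (norm (q - p))\<^sup>2"
    using assms(1) proj_set_normal[OF p] \<open>p \<in> C\<close> \<open>q \<in> C\<close>
    unfolding prox_regular_def by (fastforce simp: dist_norm)
  also have "\<dots> < 1 * (norm (q - p))\<^sup>2"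
    by (intro mult_strict_right_mono near) (simp add: \<open>q \<noteq> p\<close>)
  finally show False by simp
qed

text \<open>\<open>proj\<close> is specified only where \<open>proj_set\<close> is a singleton.
  Closedness supplies a nearest point; being no farther from \<open>y\<close> than \<open>c\<close>,
  it inherits the distance bound that uniqueness requires.\<close>

lemma prox_regular_proj_mem:
  fixes C :: "'a::{real_inner, heine_borel} set"
  assumes "\<alpha> > 0" and "prox_regular \<alpha> C" and c: "c \<in> C" "dist y c < 1 / (2 * \<alpha>)"
  shows "proj C y \<in> C"
proof -
  have "closed C"
    using assms(2) by (simp add: prox_regular_def clarke_regular_def)
  then obtain p where "p \<in> C" "\<And>z. z \<in> C \<Longrightarrow> dist y p \<le> dist y z"
    using c(1) distance_attains_inf[of C y] by blast
  then have p: "p \<in> proj_set C y" and "dist y p < 1 / (2 * \<alpha>)"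
    using c by (auto simp: proj_set_def intro: le_less_trans)
  then have "2 * \<alpha> * dist y p < 1"
    using \<open>\<alpha> > 0\<close> by (simp add: field_simps)
  then have "proj_set C y = {p}"
    using prox_regular_proj_set_unique[OF assms(2) p] p by blast
  then show ?thesis
    using \<open>p \<in> C\<close> by (simp add: proj_def)
qed

lemma directional_derivative_in_tangent_cone:
  fixes f :: "'a::real_normed_vector \<Rightarrow> 'b::real_normed_vector"
  assumes "has_directional_derivative f d x v" and "\<epsilon> > 0"
    and mem: "\<And>h. 0 < h \<Longrightarrow> h \<le> \<epsilon> \<Longrightarrow> f (x + h *\<^sub>R v) \<in> C"
  shows "d \<in> tangent_cone C (f x)"
proof -
  \<comment> \<open>\<open>tangent_cone\<close> constrains every index, so all terms, including the
    one at \<open>k = 0\<close>, must lie in the interval from 0 to \<epsilon> where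
    \<open>mem\<close> applies.\<close>
  define \<delta> where "\<delta> k = \<epsilon> * inverse (real (Suc k))" for k
  define xs where "xs k = f (x + \<delta> k *\<^sub>R v)" for k
  have \<delta>: "\<delta> k > 0" "\<delta> k \<le> \<epsilon>" for k
    using \<open>\<epsilon> > 0\<close> by (auto simp: \<delta>_def field_simps)
  have \<delta>0: "\<delta> \<longlonglongrightarrow> 0"
    unfolding \<delta>_def using tendsto_mult_left[OF LIMSEQ_inverse_real_of_nat, of \<epsilon>] by simp
  have "filterlim \<delta> (at_right 0) sequentially"
    using \<delta>0 \<delta>(1) by (simp add: filterlim_at less_imp_neq[symmetric])
  with assms(1) have lim: "(\<lambda>k. (xs k - f x) /\<^sub>R \<delta> k) \<longlonglongrightarrow> d"
    unfolding has_directional_derivative_def xs_def by (rule filterlim_compose)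
  \<comment> \<open>Convergence of \<open>xs\<close> to \<open>f x\<close> comes from the difference
    quotients: they converge, and the steps multiplying them tend to 0.\<close>
  have "(\<lambda>k. f x + \<delta> k *\<^sub>R ((xs k - f x) /\<^sub>R \<delta> k)) \<longlonglongrightarrow> f x + 0 *\<^sub>R d"
    by (intro tendsto_intros lim \<delta>0)
  moreover have "f x + \<delta> k *\<^sub>R ((xs k - f x) /\<^sub>R \<delta> k) = xs k" for k
    using \<delta>(1)[of k] by simp
  ultimately have "xs \<longlonglongrightarrow> f x" by simp
  moreover have "xs k \<in> C" for k
    unfolding xs_def by (intro mem \<delta>)
  ultimately show ?thesis
    unfolding tangent_cone_def using \<delta>(1) \<delta>0 lim by blast
qed

theorem lemma5:
  fixes C :: "(real ^ 'n) set" and \<alpha> :: real and x v d :: "real ^ 'n"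
  assumes "\<alpha> > 0"
    and "prox_regular \<alpha> C"
    and "x \<in> C + ball 0 (1 / (2 * \<alpha>))"
    and "has_directional_derivative (proj C) d x v"
  shows "d \<in> tangent_cone C (proj C x)"
proof -
  obtain c where c: "c \<in> C" "dist x c < 1 / (2 * \<alpha>)"
    using assms(3) by (auto simp: set_plus_def dist_norm)
  \<comment> \<open>The \<open>+ 1\<close> covers \<open>v = 0\<close> and leaves a slack of
    \<epsilon> in the distance bound, so that it stays strict even at
    \<open>h = \<epsilon>\<close>.\<close>
  define \<epsilon> where "\<epsilon> = (1 / (2 * \<alpha>) - dist x c) / (norm v + 1)"
  have "norm v + 1 > 0"
    by (simp add: add_nonneg_pos)
  then have "\<epsilon> > 0" and "\<epsilon> * (norm v + 1) = 1 / (2 * \<alpha>) - dist x c"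
    using c(2) by (simp_all add: \<epsilon>_def)
  then have \<epsilon>: "\<epsilon> * norm v + \<epsilon> = 1 / (2 * \<alpha>) - dist x c"
    by (simp add: distrib_left)
  have "proj C (x + h *\<^sub>R v) \<in> C" if "0 < h" "h \<le> \<epsilon>" for h
  proof (rule prox_regular_proj_mem[OF assms(1,2) c(1)])
    have "dist (x + h *\<^sub>R v) c \<le> dist (x + h *\<^sub>R v) x + dist x c"
      by (rule dist_triangle)
    also have "dist (x + h *\<^sub>R v) x = h * norm v"
      using that by (simp add: dist_norm)
    also have "h * norm v \<le> \<epsilon> * norm v"
      using that by (simp add: mult_right_mono)
    finally show "dist (x + h *\<^sub>R v) c < 1 / (2 * \<alpha>)"
      using \<epsilon> \<open>\<epsilon> > 0\<close> by simp
  qed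
  with assms(4) \<open>\<epsilon> > 0\<close> show ?thesis
    by (rule directional_derivative_in_tangent_cone)
qed

end
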